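(* Let $p=2n+1$ be an odd prime. Then $$\sum_{k=0}^{p-1}\frac{\binom{2k}k\binom{2k}{k+d}}{(2k-1)8^k}\equiv0\pmod p$$ for every $d\in\{0,1,\ldots,n\}$ with $d\equiv n\pmod 2$.
   Context: The congruence is in the ring of rational numbers with denominator prime to $p$. *)

theory Defs
  imports Complex_Main "HOL-Computational_Algebra.Primes" "HOL-Number_Theory.Cong"
begin

text \<open>The ring of rational numbers whose denominator (in lowest terms) is prime to \<open>p\<close>.\<close>

definition p_integral_rats :: "nat \<Rightarrow> rat set" where
  "p_integral_rats p = {x. coprime (snd (quotient_of x)) (int p)}"

text \<open>Congruence modulo the principal ideal generated by \<open>p\<close> in that ring. Both sides are required
  to lie in the ring, so the relation is never satisfied by rationals that are not \<open>p\<close>-integral.\<close>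

definition rat_cong :: "nat \<Rightarrow> rat \<Rightarrow> rat \<Rightarrow> bool" where
  "rat_cong p x y \<longleftrightarrow>
     x \<in> p_integral_rats p \<and> y \<in> p_integral_rats p \<and>
     (\<exists>z \<in> p_integral_rats p. x - y = of_nat p * z)"

end

theory Submission
  imports Defs "HOL-Computational_Algebra.Polynomial"
begin

text \<open>
  Put \<open>N = n + 1\<close> and \<open>a k = (2k choose k) / (2k - 1)\<close>, which is an integer. Since
  \<open>(k + 1) a (k + 1) = 2 (2k - 1) a k\<close> and \<open>2N \<equiv> 1\<close> modulo \<open>p\<close>, the sequences \<open>a k\<close> and
  \<open>- (-4)^k (N choose k)\<close> satisfy the same first-order recurrence modulo \<open>p\<close> and hence agree for
  \<open>k < p\<close>. The sum thus becomes, up to sign,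
  \<open>\<Sum>k\<le>N. (N choose k) (-1/2)^k (2k choose (k + d))\<close>, and as \<open>(2k choose (k + d))\<close> is the coefficient
  of \<open>x^d\<close> in \<open>(x + 2 + 1/x)^k\<close>, this is the coefficient of \<open>x^d\<close> in \<open>(-(x + 1/x)/2)^N\<close>. It vanishes
  because \<open>N + d\<close> is odd.
\<close>

text \<open>The denominator in lowest terms divides \<open>b\<close>, hence inherits coprimality to
  \<open>p\<close>.\<close>

lemma of_int_div_in_p_integral_rats:
  assumes "coprime b (int p)" and "b \<noteq> 0"
  shows "of_int a / of_int b \<in> p_integral_rats p"
proof -
  define x :: rat where "x = of_int a / of_int b"
  obtain r s where rs: "quotient_of x = (r, s)" by (cases "quotient_of x")
  have "s > 0" "coprime r s" and x: "x = of_int r / of_int s"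
    using rs quotient_of_denom_pos quotient_of_coprime quotient_of_div by auto
  then have "(of_int (r * b) :: rat) = of_int (a * s)"
    using assms(2) unfolding x_def by (simp add: field_simps)
  then have "r * b = a * s" by (simp only: of_int_eq_iff)
  then have "s dvd r * b" by simp
  then have "s dvd b"
    using \<open>coprime r s\<close> coprime_commute coprime_dvd_mult_right_iff by blast
  then have "coprime s (int p)" using assms(1) coprime_divisors dvd_refl by blast
  then show ?thesis by (simp add: p_integral_rats_def x_def[symmetric] rs)
qed

text \<open>Each factor \<open>1 + x^2\<close> only combines coefficients at \<open>i\<close> and
  \<open>i - 2\<close>, so parity is preserved.\<close>

lemma coeff_one_plus_square_power_odd:
  assumes "odd i"
  shows "coeff ([:1, 0, 1:] ^ N :: int poly) i = 0"
  using assms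
proof (induction N arbitrary: i)
  case 0
  then show ?case by (cases i) auto
next
  case (Suc N)
  then show ?case by (auto simp: coeff_pCons split: nat.split)
qed

lemma coeff_one_plus_X_power:
  "coeff ([:1, 1:] ^ m :: int poly) i = int (m choose i)"
proof (cases "i \<le> m")
  case False
  then show ?thesis by (simp add: coeff_eq_0 degree_linear_power binomial_eq_0)
qed (simp add: coeff_linear_poly_power)

text \<open>Expand \<open>(1 + x^2)^N = ((1 + x)^2 - 2 x)^N\<close> binomially and compare
  coefficients at the odd exponent \<open>N + d\<close>. This is the Laurent identity multiplied by
  a power of \<open>x\<close>.\<close>

lemma alternating_sum_binomial_central_zero:
  assumes "odd (N + d)"
  shows "(\<Sum>k\<le>N. int (N choose k) * (-2) ^ (N - k) * int ((2 * k) choose (k + d))) = 0"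
proof -
  have coeff: "coeff ([:1, 1:] ^ (2 * k) * monom (-2) 1 ^ (N - k) :: int poly) (N + d)
      = (-2) ^ (N - k) * int ((2 * k) choose (k + d))" if "k \<le> N" for k
  proof -
    have "N + d = (k + d) + (N - k)" using that by simp
    then show ?thesis
      by (simp add: monom_power coeff_monom_mult mult.commute[of _ "monom _ _"]
          coeff_one_plus_X_power add.commute)
  qed
  have "([:1, 0, 1:] :: int poly) = [:1, 1:] ^ 2 + monom (-2) 1"
    by (simp add: power2_eq_square monom_Suc monom_0)
  then have "([:1, 0, 1:] :: int poly) ^ N
      = (\<Sum>k\<le>N. of_nat (N choose k) * ([:1, 1:] ^ (2 * k) * monom (-2) 1 ^ (N - k)))"
    by (simp only: binomial_ring power_mult mult.assoc)
  then have "coeff ([:1, 0, 1:] ^ N :: int poly) (N + d)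
      = (\<Sum>k\<le>N. int (N choose k) * ((-2) ^ (N - k) * int ((2 * k) choose (k + d))))"
    by (simp add: coeff_sum of_nat_poly coeff del: One_nat_def cong: sum.cong_simp)
  then show ?thesis
    using coeff_one_plus_square_power_odd[OF assms, of N] by (simp add: mult.assoc)
qed

text \<open>The integer \<open>a k\<close>, written without division so that integrality is evident;
  at \<open>Suc k\<close> it is twice the \<open>k\<close>-th Catalan number.\<close>

fun central_quot :: "nat \<Rightarrow> int" where
  "central_quot 0 = -1"
| "central_quot (Suc k) = 4 * int ((2 * k) choose k) - int ((2 * Suc k) choose Suc k)"

lemma Suc_times_central_binomial:
  "int (Suc k) * int ((2 * Suc k) choose Suc k) = 2 * (2 * int k + 1) * int ((2 * k) choose k)"
proof -
  have "Suc k * ((2 * Suc k) choose Suc k) = (2 * Suc k) * (Suc (2 * k) choose k)"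
    using Suc_times_binomial[of k "Suc (2 * k)"] by (simp only: mult_Suc_right add_2_eq_Suc)
  \<comment> \<open>The extra factor \<open>Suc k\<close> lets absorption be applied a second time;
    it is cancelled at the end.\<close>
  then have "Suc k * (Suc k * ((2 * Suc k) choose Suc k))
      = 2 * Suc k * (Suc k * (Suc (2 * k) choose k))"
    by (simp only: mult.left_commute)
  also have "\<dots> = 2 * Suc k * (Suc k * (Suc (2 * k) choose Suc k))"
    using binomial_symmetric[of k "Suc (2 * k)"] by simp
  also have "\<dots> = 2 * Suc k * (Suc (2 * k) * ((2 * k) choose k))"
    by (simp only: Suc_times_binomial)
  finally have "Suc k * (Suc k * ((2 * Suc k) choose Suc k))
      = Suc k * (2 * (2 * k + 1) * ((2 * k) choose k))"
    by (simp only: ac_simps) simp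
  then have "Suc k * ((2 * Suc k) choose Suc k) = 2 * (2 * k + 1) * ((2 * k) choose k)"
    by (simp only: mult_cancel1) simp
  then have "int (Suc k * ((2 * Suc k) choose Suc k)) = int (2 * (2 * k + 1) * ((2 * k) choose k))"
    by (simp only:)
  then show ?thesis by (simp only: of_nat_mult of_nat_add of_nat_numeral of_nat_1)
qed

lemma central_quot_mult:
  "(2 * int k - 1) * central_quot k = int ((2 * k) choose k)"
proof (cases k)
  case (Suc j)
  then show ?thesis
    using Suc_times_central_binomial[of j] by (simp add: algebra_simps)
qed simp

lemma central_quot_rec:
  "int (Suc k) * central_quot (Suc k) = 2 * (2 * int k - 1) * central_quot k"
  using Suc_times_central_binomial[of k] central_quot_mult[of k] by (simp add: algebra_simps)

lemma central_quot_cong: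
  assumes "prime p" and "p = 2 * n + 1" and "k < p"
  shows "[central_quot k = - ((-4) ^ k * int (Suc n choose k))] (mod int p)"
  using \<open>k < p\<close>
proof (induction k)
  case (Suc k)
  define b where "b j = - ((-4) ^ j * int (Suc n choose j))" for j
  have "int (Suc k) * int (Suc n choose Suc k) = (int (Suc n) - int k) * int (Suc n choose k)"
  proof (cases "k \<le> Suc n")
    case True
    then show ?thesis
      using binomial_absorb_comp[of "Suc n" k] Suc_times_binomial[of k n]
      by (metis of_nat_diff of_nat_mult diff_Suc_1)
  qed (simp add: binomial_eq_0)
  then have b: "int (Suc k) * b (Suc k) = -4 * (int (Suc n) - int k) * b k"
    unfolding b_def power_Suc by (metis (no_types, opaque_lifting) mult.assoc mult.left_commute mult_minus_right)
  \<comment> \<open>The two recurrence factors differ by \<open>4 * n + 2\<close>, that is, by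
    \<open>2 * p\<close>.\<close>
  have "[2 * (2 * int k - 1) = -4 * (int (Suc n) - int k)] (mod int p)"
  proof -
    have "2 * (2 * int k - 1) - (-4 * (int (Suc n) - int k)) = int p * 2"
      using assms(2) by simp
    then show ?thesis by (metis cong_iff_dvd_diff dvd_triv_left)
  qed
  moreover have "[central_quot k = b k] (mod int p)"
    using Suc unfolding b_def by simp
  ultimately have "[int (Suc k) * central_quot (Suc k) = int (Suc k) * b (Suc k)] (mod int p)"
    unfolding central_quot_rec b by (rule cong_mult)
  \<comment> \<open>As \<open>0 < Suc k < p\<close>, the factor \<open>Suc k\<close> is invertible
    modulo \<open>p\<close>.\<close>
  moreover have "coprime (int (Suc k)) (int p)"
    using Suc.prems assms(1) by (simp only: coprime_int_iff)
      (metis coprime_commute nat_dvd_not_less prime_imp_coprime zero_less_Suc)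
  ultimately have "[central_quot (Suc k) = b (Suc k)] (mod int p)"
    by (simp add: cong_mult_lcancel del: central_quot.simps)
  then show ?case by (simp only: b_def)
qed simp

theorem theorem1p2:
  fixes p n d :: nat
  assumes "prime p" and "p = 2 * n + 1"
    and "d \<in> {0..n}" and "[d = n] (mod 2)"
  shows "rat_cong p
    (\<Sum>k = 0..p - 1. of_nat ((2 * k) choose k) * of_nat ((2 * k) choose (k + d))
        / ((2 * of_nat k - 1) * 8 ^ k)) 0"
proof -
  define m where "m = p - 1"
  define c where "c k = int ((2 * k) choose (k + d))" for k
  \<comment> \<open>Numerator over the common denominator \<open>8 ^ m\<close>, so that the
    congruences run over the integers.\<close>
  define M where "M = (\<Sum>k\<le>m. central_quot k * c k * 8 ^ (m - k))"
  \<comment> \<open>This gives \<open>Suc n \<le> 2 * n = m\<close>, so cutting the sum at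
    \<open>Suc n\<close> will drop only zero binomials.\<close>
  have "n \<ge> 1" using assms(1,2) by (cases n) auto
  then have Nm: "Suc n \<le> m" and "p > 0" using assms(2) by (auto simp: m_def)
  have term_eq: "of_nat ((2 * k) choose k) * of_nat ((2 * k) choose (k + d))
        / ((2 * of_nat k - 1) * 8 ^ k) = (of_int (central_quot k * c k * 8 ^ (m - k)) / 8 ^ m :: rat)"
    if "k \<le> m" for k
  proof -
    have "2 * int k - 1 \<noteq> 0" by presburger
    then have "(of_int (2 * int k - 1) :: rat) \<noteq> 0" by (simp only: of_int_eq_0_iff not_False_eq_True)
    then have nz: "(2 * of_nat k - 1 :: rat) \<noteq> 0" by simp
    have "(of_nat ((2 * k) choose k) :: rat) = of_int ((2 * int k - 1) * central_quot k)"
      by (simp only: central_quot_mult of_int_of_nat_eq)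
    moreover have "(8 ^ m :: rat) = 8 ^ k * 8 ^ (m - k)"
      using that by (simp flip: power_add)
    ultimately show ?thesis using nz by (simp add: c_def)
  qed
  have sum_eq: "(\<Sum>k = 0..p - 1. of_nat ((2 * k) choose k) * of_nat ((2 * k) choose (k + d))
        / ((2 * of_nat k - 1) * 8 ^ k)) = (of_int M / of_int (8 ^ m) :: rat)"
    unfolding M_def of_int_sum sum_divide_distrib m_def[symmetric] atLeast0AtMost
    by (rule sum.cong) (simp_all add: term_eq)
  have "[M = (\<Sum>k\<le>m. - ((-4) ^ k * int (Suc n choose k)) * c k * 8 ^ (m - k))] (mod int p)"
    unfolding M_def using assms(1,2) \<open>p > 0\<close>
    by (intro cong_sum cong_mult cong_refl central_quot_cong) (auto simp: m_def)
  also have "(\<Sum>k\<le>m. - ((-4) ^ k * int (Suc n choose k)) * c k * 8 ^ (m - k))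
      = (\<Sum>k\<le>Suc n. - ((-4) ^ k * int (Suc n choose k)) * c k * 8 ^ (m - k))"
    using Nm by (intro sum.mono_neutral_right) (auto simp: binomial_eq_0)
  also have "\<dots> = (\<Sum>k\<le>Suc n. (- (8 ^ (m - Suc n)) * (-4) ^ Suc n)
      * (int (Suc n choose k) * (-2) ^ (Suc n - k) * c k))"
  proof (rule sum.cong)
    fix k assume "k \<in> {..Suc n}"
    then have k: "m - k = (m - Suc n) + (Suc n - k)" "Suc n = k + (Suc n - k)"
      using Nm by auto
    \<comment> \<open>Split \<open>8 = (-4) * (-2)\<close>: the powers of \<open>-4\<close> complete
      \<open>(-4) ^ k\<close> to a factor independent of \<open>k\<close>, leaving the weight
      \<open>(-2) ^ (Suc n - k)\<close>.\<close>
    have "(8 :: int) ^ (m - k) = 8 ^ (m - Suc n) * ((-4) ^ (Suc n - k) * (-2) ^ (Suc n - k))"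
      by (subst k(1)) (simp add: power_add flip: power_mult_distrib)
    moreover have "(-4 :: int) ^ Suc n = (-4) ^ k * (-4) ^ (Suc n - k)"
      by (metis k(2) power_add)
    ultimately show "- ((-4) ^ k * int (Suc n choose k)) * c k * 8 ^ (m - k)
        = (- (8 ^ (m - Suc n)) * (-4) ^ Suc n) * (int (Suc n choose k) * (-2) ^ (Suc n - k) * c k)"
      by (simp only:) (simp add: algebra_simps)
  qed simp
  also have "\<dots> = 0"
  proof -
    have "odd (Suc n + d)" using assms(4) by (auto simp: cong_def)
    then show ?thesis
      unfolding sum_distrib_left[symmetric] c_def
      using alternating_sum_binomial_central_zero[of "Suc n" d]
      by (simp only: mult_zero_right not_False_eq_True)
  qed
  finally obtain q where q: "M = int p * q" by (auto simp: cong_0_iff)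
  have "coprime (2 :: int) (int p)" using assms(2) by simp
  then have cop: "coprime (8 ^ m) (int p)"
    using coprime_power_left_iff[of "2 :: int" 3 "int p"] by simp
  have "of_int M / of_int (8 ^ m) = (of_nat p * (of_int q / of_int (8 ^ m)) :: rat)"
    by (simp add: q)
  moreover have "of_int i / of_int (8 ^ m) \<in> p_integral_rats p" for i
    using cop by (intro of_int_div_in_p_integral_rats) auto
  moreover have "0 \<in> p_integral_rats p"
    using of_int_div_in_p_integral_rats[of 1 p 0] by simp
  ultimately show ?thesis
    unfolding sum_eq rat_cong_def by (metis diff_zero)
qed

end
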